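(* The two-stage distributionally robust problem of minimizing $c^\top x+\mathcal Z(x)$ over $x\in\mathcal X$ is equivalent to the tractable linear program $$\begin{array}{lll} \text{minimize} & \displaystyle c^\top x+\epsilon\lambda+\frac1I\sum_{i\in[I]}q^\top y_i\\ \text{subject to} & x\in\mathcal X,\ \lambda\in\mathbb R_+,\ y_i\in\mathbb R^{N_2} & \forall i\in[I]\\ & \phi_k,\psi_k\in\mathbb R^{N_2}&\forall k\in[K]\\ & T(x)\hat\xi_i+h(x)\le Wy_i&\forall i\in[I]\\ & q^\top\phi_k\le\lambda,\quad q^\top\psi_k\le\lambda&\forall k\in[K]\\ & T(x)\mathbf e_k/w_+\le W\phi_k,\quad -T(x)\mathbf e_k/w_-\le W\psi_k&\forall k\in[K]. \end{array}$$
   Context: Notation: $[n]=\{1,\dots,n\}$; $\mathbf e$ is the all-ones vector; $\mathbf e_k$ is the $k$-th standard basis vector of $\mathbb R^K$. Problem data: $c\in\mathbb R^{N_1}$, $\mathcal X\subseteq\mathbb R^{N_1}$ (the problem displayed in the claim is a linear program up to the constraint $x\in\mathcal X$), $q\in\mathbb R^{N_2}$, $W\in\mathbb R^{M\times N_2}$, and affine functions $T:\mathbb R^{N_1}\to\mathbb R^{M\times K}$, $h:\mathbb R^{N_1}\to\mathbb R^M$. The uncertainty affects only the constraints of the recourse problem, and the support is $\Xi=\mathbb R^K$. The recourse function is $$Z(x,\xi)=\inf\{q^\top y:\ y\in\mathbb R^{N_2},\ T(x)\xi+h(x)\le Wy\}.$$ Sufficiently expensive recourse (standing assumption): there exists $p\in\mathbb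 R_+^M$ with $W^\top p=q$. For fixed $w_+,w_->0$ define $\|\xi\|=\mathbf e^\top\max\{w_+\xi,-w_-\xi\}$ (componentwise maximum) and the reference distance $d(\xi_1,\xi_2)=\|\xi_1-\xi_2\|$. Given samples $\hat\xi_1,\dots,\hat\xi_I\in\mathbb R^K$, let $\hat{\mathbb P}_I=\frac1I\sum_{i\in[I]}\delta_{\hat\xi_i}$. For distributions on $\mathbb R^K$ with finite first moments, $W^1(\mathbb P_1,\mathbb P_2)=\inf_{\mathbb Q}\int d(\xi_1,\xi_2)\,\mathbb Q(d\xi_1,d\xi_2)$ over couplings $\mathbb Q$ of $\mathbb P_1$ and $\mathbb P_2$. For a radius $\epsilon>0$, $\mathcal B^1_\epsilon(\hat{\mathbb P}_I)$ is the set of distributions $\mathbb P$ on $\mathbb R^K$ with finite first moment and $W^1(\mathbb P,\hat{\mathbb P}_I)\le\epsilon$, and $\mathcal Z(x)=\sup_{\mathbb P\in\mathcal B^1_\epsilon(\hat{\mathbb P}_I)}\mathbb E_{\mathbb P}[Z(x,\tilde\xi)]$. "Equivalent" means that for every $x\in\mathcal X$ the infimum of the displayed objective over all variables other than $x$ equals $c^\top x+\mathcal Z(x)$ (with value $+\infty$ if infeasible), so that in particular the optimal values coincide. *)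

theory Defs
  imports "HOL-Probability.Probability"
begin

text \<open>Matrices with M rows and K columns are elements of \<open>real ^ 'k ^ 'm\<close>; the order \<open>\<le>\<close> on
  vectors is the componentwise one.\<close>

definition affine_fun :: "('a::real_vector \<Rightarrow> 'b::real_vector) \<Rightarrow> bool" where
  "affine_fun f \<longleftrightarrow> (\<exists>L b. linear L \<and> f = (\<lambda>x. L x + b))"

text \<open>The infimum is taken in the extended reals, so the value is \<open>\<infinity>\<close> if the recourse problem is
  infeasible.\<close>

definition recourse ::
  "real ^ 'n2 \<Rightarrow> real ^ 'n2 ^ 'm \<Rightarrow> (real ^ 'n1 \<Rightarrow> real ^ 'k ^ 'm) \<Rightarrow> (real ^ 'n1 \<Rightarrow> real ^ 'm)
    \<Rightarrow> real ^ 'n1 \<Rightarrow> real ^ 'k \<Rightarrow> ereal" where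
  "recourse q W T h x \<xi> = (INF y \<in> {y. T x *v \<xi> + h x \<le> W *v y}. ereal (q \<bullet> y))"

definition sufficiently_expensive :: "real ^ 'n2 \<Rightarrow> real ^ 'n2 ^ 'm \<Rightarrow> bool" where
  "sufficiently_expensive q W \<longleftrightarrow> (\<exists>p. 0 \<le> p \<and> transpose W *v p = q)"

text \<open>For \<open>wp \<noteq> wm\<close> the next two functions are not symmetric, so the order of the arguments matters
  below.\<close>

definition ref_norm :: "real \<Rightarrow> real \<Rightarrow> real ^ 'k \<Rightarrow> real" where
  "ref_norm wp wm \<xi> = (\<Sum>k\<in>UNIV. max (wp * \<xi> $ k) (- wm * \<xi> $ k))"

definition ref_dist :: "real \<Rightarrow> real \<Rightarrow> real ^ 'k \<Rightarrow> real ^ 'k \<Rightarrow> real" where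
  "ref_dist wp wm \<xi>1 \<xi>2 = ref_norm wp wm (\<xi>1 - \<xi>2)"

definition finite_moment_distrs :: "(real ^ 'k) measure set" where
  "finite_moment_distrs = {P. prob_space P \<and> sets P = sets borel \<and> integrable P norm}"

definition empirical :: "nat \<Rightarrow> (nat \<Rightarrow> real ^ 'k) \<Rightarrow> (real ^ 'k) measure" where
  "empirical n s = distr (uniform_count_measure {1..n}) borel s"

lemma emeasure_empirical:
  assumes "A \<in> sets borel" "n \<ge> 1"
  shows "emeasure (empirical n s) A = ennreal (1 / real n * (\<Sum>i = 1..n. indicator A (s i)))"
proof -
  have "emeasure (empirical n s) A = emeasure (uniform_count_measure {1..n}) (s -` A \<inter> {1..n})"
    using assms unfolding empirical_def
    by (subst emeasure_distr)
      (auto simp: measurable_def sets_uniform_count_measure space_uniform_count_measure)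
  also have "\<dots> = ennreal (real (card (s -` A \<inter> {1..n})) / real n)"
    by (subst emeasure_uniform_count_measure) auto
  also have "real (card (s -` A \<inter> {1..n})) = (\<Sum>i = 1..n. indicator (s -` A) i)"
    by (simp add: indicator_def sum.If_cases Int_commute vimage_def)
  also have "\<dots> = (\<Sum>i = 1..n. indicator A (s i))"
    by (simp add: indicator_def)
  finally show ?thesis by simp
qed

definition couplings ::
  "(real ^ 'k) measure \<Rightarrow> (real ^ 'k) measure \<Rightarrow> ((real ^ 'k) \<times> (real ^ 'k)) measure set" where
  "couplings P1 P2 = {Q. prob_space Q \<and> sets Q = sets (borel \<Otimes>\<^sub>M borel) \<and>
      distr Q borel fst = P1 \<and> distr Q borel snd = P2}"

definition wasserstein1 ::
  "(real ^ 'k \<Rightarrow> real ^ 'k \<Rightarrow> real) \<Rightarrow> (real ^ 'k) measure \<Rightarrow> (real ^ 'k) measure \<Rightarrow> ennreal" where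
  "wasserstein1 d P1 P2 =
     (INF Q \<in> couplings P1 P2. \<integral>\<^sup>+ z. ennreal (d (fst z) (snd z)) \<partial>Q)"

definition wasserstein_ball ::
  "(real ^ 'k \<Rightarrow> real ^ 'k \<Rightarrow> real) \<Rightarrow> real \<Rightarrow> (real ^ 'k) measure \<Rightarrow> (real ^ 'k) measure set" where
  "wasserstein_ball d \<epsilon> P0 = {P \<in> finite_moment_distrs. wasserstein1 d P P0 \<le> ennreal \<epsilon>}"

text \<open>Expectation of an extended-real function as positive part minus negative part
  (\<open>e2ennreal\<close> maps negative values to 0). Under sufficiently expensive recourse,
  \<open>recourse q W T h x\<close> is bounded below by an affine function, so under distributions with finite
  first moment the negative part is integrable and \<open>\<infinity> - \<infinity>\<close> does not occur.\<close>

definition ereal_expectation :: "'a measure \<Rightarrow> ('a \<Rightarrow> ereal) \<Rightarrow> ereal" where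
  "ereal_expectation P f =
     enn2ereal (\<integral>\<^sup>+ \<xi>. e2ennreal (f \<xi>) \<partial>P) - enn2ereal (\<integral>\<^sup>+ \<xi>. e2ennreal (- f \<xi>) \<partial>P)"

definition worst_case ::
  "real ^ 'n2 \<Rightarrow> real ^ 'n2 ^ 'm \<Rightarrow> (real ^ 'n1 \<Rightarrow> real ^ 'k ^ 'm) \<Rightarrow> (real ^ 'n1 \<Rightarrow> real ^ 'm)
    \<Rightarrow> real \<Rightarrow> real \<Rightarrow> real \<Rightarrow> nat \<Rightarrow> (nat \<Rightarrow> real ^ 'k) \<Rightarrow> real ^ 'n1 \<Rightarrow> ereal" where
  "worst_case q W T h wp wm \<epsilon> n s x =
     (SUP P \<in> wasserstein_ball (ref_dist wp wm) \<epsilon> (empirical n s).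
        ereal_expectation P (recourse q W T h x))"

text \<open>The decision \<open>y\<close> is indexed by naturals; only the entries in \<open>{1..n}\<close> matter.\<close>

definition lp_objective ::
  "real ^ 'n1 \<Rightarrow> real ^ 'n2 \<Rightarrow> real \<Rightarrow> nat \<Rightarrow> real ^ 'n1 \<Rightarrow> real \<Rightarrow> (nat \<Rightarrow> real ^ 'n2) \<Rightarrow> real" where
  "lp_objective c q \<epsilon> n x l y = c \<bullet> x + \<epsilon> * l + 1 / real n * (\<Sum>i = 1..n. q \<bullet> y i)"

definition lp_feasible ::
  "(real ^ 'n1) set \<Rightarrow> real ^ 'n2 \<Rightarrow> real ^ 'n2 ^ 'm \<Rightarrow> (real ^ 'n1 \<Rightarrow> real ^ 'k ^ 'm)
    \<Rightarrow> (real ^ 'n1 \<Rightarrow> real ^ 'm) \<Rightarrow> real \<Rightarrow> real \<Rightarrow> nat \<Rightarrow> (nat \<Rightarrow> real ^ 'k)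
    \<Rightarrow> real ^ 'n1 \<Rightarrow> real \<Rightarrow> (nat \<Rightarrow> real ^ 'n2) \<Rightarrow> ('k \<Rightarrow> real ^ 'n2) \<Rightarrow> ('k \<Rightarrow> real ^ 'n2) \<Rightarrow> bool" where
  "lp_feasible X q W T h wp wm n s x l y \<phi> \<psi> \<longleftrightarrow>
     x \<in> X \<and> 0 \<le> l \<and>
     (\<forall>i\<in>{1..n}. T x *v s i + h x \<le> W *v y i) \<and>
     (\<forall>k. q \<bullet> \<phi> k \<le> l \<and> q \<bullet> \<psi> k \<le> l) \<and>
     (\<forall>k. (1 / wp) *\<^sub>R (T x *v axis k 1) \<le> W *v \<phi> k \<and>
          - ((1 / wm) *\<^sub>R (T x *v axis k 1)) \<le> W *v \<psi> k)"

end

theory Submission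
  imports Defs
begin

text \<open>By linear programming duality the recourse function is a supremum of affine functions
  \<open>p \<bullet> (T x *v \<xi> + h x)\<close> over the dual feasible set, which does not depend on \<open>\<xi>\<close>.
  A feasible \<open>l\<close> of the linear program bounds the dual slopes in the extreme directions
  \<open>axis k 1 / wp\<close> and \<open>- axis k 1 / wm\<close> of the unit ball of the reference norm, so the recourse
  function is \<open>l\<close>-Lipschitz and every coupling bounds its expectation by the objective.
  Conversely, transporting a vanishing fraction of the empirical mass arbitrarily far in such a
  direction shows that \<open>\<epsilon>\<close> times each dual slope can be gained on top of the empirical mean.
  When the worst case is finite, what it exceeds the empirical mean by, divided by \<open>\<epsilon>\<close>,
  is a feasible \<open>l\<close>.\<close>

section \<open>Linear programming duality and the recourse function\<close>

text \<open>A finitely generated cone is closed, so a hyperplane strictly separates \<open>x\<close>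
  from it. Invariance under scaling then turns the separating constant into 0 on the
  generators.\<close>

lemma farkas_finite_cone:
  fixes S :: "'a::euclidean_space set"
  assumes "finite S" and "x \<notin> convex_cone hull S"
  shows "\<exists>u. u \<bullet> x < 0 \<and> (\<forall>z\<in>S. 0 \<le> u \<bullet> z)"
proof -
  have "convex (convex_cone hull S)" "closed (convex_cone hull S)"
    using assms(1) by (simp_all add: convex_convex_cone_hull closed_convex_cone_hull)
  then obtain u b where ub: "u \<bullet> x < b" "\<And>z. z \<in> convex_cone hull S \<Longrightarrow> b < u \<bullet> z"
    using separating_hyperplane_closed_point[OF _ _ assms(2)] by auto
  have b: "b < 0"
    using ub(2)[OF convex_cone_hull_contains_0] by simp
  have "0 \<le> u \<bullet> z" if "z \<in> S" for z
  proof (rule ccontr)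
    assume neg: "\<not> 0 \<le> u \<bullet> z"
    \<comment> \<open>Both \<open>b\<close> and \<open>u \<bullet> z\<close> are negative, so the
      factor is positive; on the scaled generator \<open>u\<close> takes exactly the value
      \<open>b\<close>, which the strict separation forbids.\<close>
    have "(b / (u \<bullet> z)) *\<^sub>R z \<in> convex_cone hull S"
      using that b neg by (intro convex_cone_hull_mul) (auto simp: hull_inc divide_nonpos_neg)
    from ub(2)[OF this] neg show False by simp
  qed
  with ub(1) b show ?thesis by (intro exI[of _ u]) auto
qed

text \<open>Feasible set of the dual of minimizing \<open>q \<bullet> y\<close> subject to
  \<open>a \<le> W *v y\<close>. The free variable \<open>y\<close> turns the dual constraint into
  an equality, and \<open>a\<close> enters only the dual objective
  \<open>p \<bullet> a\<close>.\<close>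

definition lp_dual :: "real ^ 'n2 \<Rightarrow> real ^ 'n2 ^ 'm \<Rightarrow> (real ^ 'm) set" where
  "lp_dual q W = {p. 0 \<le> p \<and> transpose W *v p = q}"

lemma inner_mono_vec:
  fixes p a b :: "real ^ 'm"
  assumes "0 \<le> p" and "a \<le> b"
  shows "p \<bullet> a \<le> p \<bullet> b"
  using assms by (auto simp: inner_vec_def less_eq_vec_def intro!: sum_mono mult_left_mono)

lemma lp_weak_duality:
  assumes "p \<in> lp_dual q W" and "a \<le> W *v y"
  shows "p \<bullet> a \<le> q \<bullet> y"
proof -
  have "p \<bullet> a \<le> p \<bullet> (W *v y)"
    using assms by (intro inner_mono_vec) (auto simp: lp_dual_def)
  also have "\<dots> = q \<bullet> y"
    using assms by (auto simp: lp_dual_def dot_lmul_matrix[symmetric])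
  finally show ?thesis .
qed

text \<open>The pairs of a right-hand side and a cost budget that some \<open>y\<close> can meet.
  Being a convex cone, the set contains a conic hull as soon as it contains the generators.\<close>

lemma convex_cone_primal_values:
  fixes W :: "real ^ 'n2 ^ 'm"
  shows "convex_cone {z. \<exists>y. fst z \<le> W *v y \<and> q \<bullet> y \<le> snd z}" (is "convex_cone ?C")
proof -
  have "0 \<in> ?C" by (auto intro!: exI[of _ 0])
  moreover have "z + z' \<in> ?C" if zz: "z \<in> ?C" "z' \<in> ?C" for z z'
  proof -
    obtain y y' where "fst z \<le> W *v y" "q \<bullet> y \<le> snd z" "fst z' \<le> W *v y'" "q \<bullet> y' \<le> snd z'"
      using zz by auto
    then show ?thesis
      by (auto simp: less_eq_vec_def matrix_vector_right_distrib inner_add_right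
          intro!: add_mono exI[of _ "y + y'"])
  qed
  moreover have "t *\<^sub>R z \<in> ?C" if z: "z \<in> ?C" and t: "0 \<le> t" for z t
  proof -
    obtain y where "fst z \<le> W *v y" "q \<bullet> y \<le> snd z"
      using z by auto
    with t show ?thesis
      by (auto simp: less_eq_vec_def matrix_vector_mult_scaleR
          intro!: mult_left_mono exI[of _ "t *\<^sub>R y"])
  qed
  ultimately show ?thesis by (auto simp: convex_cone_iff)
qed

text \<open>Farkas applied to the pair \<open>(a, r)\<close> of right-hand side and budget. The form
  with a threshold also yields attainment: if no dual value exceeds \<open>r\<close>, some primal
  \<open>y\<close> costs at most \<open>r\<close>. The point \<open>p0\<close> serves the
  certificates that are only recession directions of the dual set.\<close>

lemma lp_strong_duality:
  fixes W :: "real ^ 'n2 ^ 'm"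
  assumes p0: "p0 \<in> lp_dual q W"
    and infeasible: "\<not> (\<exists>y. a \<le> W *v y \<and> q \<bullet> y \<le> r)"
  shows "\<exists>p\<in>lp_dual q W. r < p \<bullet> a"
proof -
  \<comment> \<open>Columns with both signs generate the effect of a free \<open>y\<close>; the
    negative unit vectors provide slack in the constraints, and \<open>(0, 1)\<close> provides slack
    in the cost.\<close>
  define S where "S = range (\<lambda>j. (W *v axis j 1, q $ j)) \<union> range (\<lambda>j. - (W *v axis j 1, q $ j))
    \<union> range (\<lambda>i. (- axis i 1 :: real ^ 'm, 0)) \<union> {(0, 1)}"
  have "S \<subseteq> {z. \<exists>y. fst z \<le> W *v y \<and> q \<bullet> y \<le> snd z}"
  proof -
    have "\<exists>y. W *v axis j 1 \<le> W *v y \<and> q \<bullet> y \<le> q $ j" for j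
      by (rule exI[of _ "axis j 1"]) (simp add: inner_axis)
    moreover have "\<exists>y. - (W *v axis j 1) \<le> W *v y \<and> q \<bullet> y \<le> - q $ j" for j
      by (rule exI[of _ "- axis j 1"])
        (simp add: inner_axis linear_neg[OF matrix_vector_mul_linear])
    moreover have "\<exists>y. - axis i 1 \<le> W *v y \<and> q \<bullet> y \<le> 0" for i
      by (rule exI[of _ 0]) (simp add: less_eq_vec_def axis_def)
    moreover have "\<exists>y. 0 \<le> W *v y \<and> q \<bullet> y \<le> 1"
      by (rule exI[of _ 0]) simp
    ultimately show ?thesis by (auto simp: S_def)
  qed
  then have "convex_cone hull S \<subseteq> {z. \<exists>y. fst z \<le> W *v y \<and> q \<bullet> y \<le> snd z}"
    by (intro hull_minimal convex_cone_primal_values)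
  with infeasible have "(a, r) \<notin> convex_cone hull S" by auto
  moreover have "finite S" by (simp add: S_def)
  ultimately obtain u \<mu> where sep: "(u, \<mu>) \<bullet> (a, r) < 0" "\<And>z. z \<in> S \<Longrightarrow> 0 \<le> (u, \<mu>) \<bullet> z"
    using farkas_finite_cone[of S "(a, r)"] by (metis surj_pair)
  define p where "p = - u"
  have \<mu>: "0 \<le> \<mu>" using sep(2)[of "(0, 1)"] by (simp add: S_def)
  have p_nonneg: "0 \<le> p"
  proof -
    have "0 \<le> (u, \<mu>) \<bullet> (- axis i 1, 0)" for i by (rule sep(2)) (simp add: S_def)
    then show ?thesis by (simp add: p_def less_eq_vec_def inner_axis)
  qed
  have Wp: "transpose W *v p = \<mu> *\<^sub>R q"
  proof -
    have "p \<bullet> (W *v axis j 1) = \<mu> * q $ j" for j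
    proof -
      have "0 \<le> (u, \<mu>) \<bullet> (W *v axis j 1, q $ j)" "0 \<le> (u, \<mu>) \<bullet> - (W *v axis j 1, q $ j)"
        by (rule sep(2); simp add: S_def)+
      then show ?thesis by (simp add: p_def)
    qed
    then have "(p v* W) \<bullet> axis j 1 = \<mu> * q $ j" for j by (simp add: dot_lmul_matrix)
    then show ?thesis by (simp add: vec_eq_iff inner_axis)
  qed
  have gain: "\<mu> * r < p \<bullet> a" using sep(1) by (simp add: p_def)
  show ?thesis
  proof (cases "\<mu> = 0")
    case False
    with \<mu> have pos: "0 < \<mu>" by simp
    have "inverse \<mu> *\<^sub>R p \<in> lp_dual q W"
      using pos p_nonneg Wp
      by (auto simp: lp_dual_def less_eq_vec_def matrix_vector_mult_scaleR
          simp del: transpose_matrix_vector)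
    moreover have "r < (inverse \<mu> *\<^sub>R p) \<bullet> a" using gain pos by (simp add: field_simps)
    ultimately show ?thesis by blast
  next
    case True
    \<comment> \<open>For \<open>\<mu> = 0\<close> the vector \<open>p\<close> is a recession
      direction of the dual set with \<open>p \<bullet> a > 0\<close>. This \<open>t\<close> makes
      the gain along the ray from \<open>p0\<close> exceed the deficit
      \<open>r - p0 \<bullet> a\<close>.\<close>
    define t where "t = (\<bar>r - p0 \<bullet> a\<bar> + 1) / (p \<bullet> a)"
    have pa: "0 < p \<bullet> a" using gain True by simp
    then have t: "0 \<le> t" "t * (p \<bullet> a) = \<bar>r - p0 \<bullet> a\<bar> + 1" by (simp_all add: t_def)
    have "p0 + t *\<^sub>R p \<in> lp_dual q W"
      using p0 t(1) p_nonneg Wp True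
      by (auto simp: lp_dual_def less_eq_vec_def matrix_vector_mult_scaleR
          matrix_vector_right_distrib simp del: transpose_matrix_vector)
    moreover have "r < (p0 + t *\<^sub>R p) \<bullet> a" using t(2) by (simp add: inner_add_left)
    ultimately show ?thesis by blast
  qed
qed

text \<open>A real \<open>r\<close> strictly between the two sides would be a budget that no primal
  \<open>y\<close> meets, so some dual point would have value above \<open>r\<close>. The identity
  includes the value \<open>\<infinity>\<close> of an infeasible recourse problem.\<close>

lemma recourse_eq_SUP:
  assumes "sufficiently_expensive q W"
  shows "recourse q W T h x \<xi> = (SUP p\<in>lp_dual q W. ereal (p \<bullet> (T x *v \<xi> + h x)))"
proof (rule antisym)
  let ?a = "T x *v \<xi> + h x"
  obtain p0 where p0: "p0 \<in> lp_dual q W"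
    using assms by (auto simp: sufficiently_expensive_def lp_dual_def)
  show "recourse q W T h x \<xi> \<le> (SUP p\<in>lp_dual q W. ereal (p \<bullet> ?a))"
  proof (rule ccontr)
    assume "\<not> ?thesis"
    then have "(SUP p\<in>lp_dual q W. ereal (p \<bullet> ?a)) < recourse q W T h x \<xi>" by simp
    then obtain r where r: "(SUP p\<in>lp_dual q W. ereal (p \<bullet> ?a)) < ereal r" "ereal r < recourse q W T h x \<xi>"
      using ereal_dense2 by blast
    have "\<not> (\<exists>y. ?a \<le> W *v y \<and> q \<bullet> y \<le> r)"
    proof
      assume "\<exists>y. ?a \<le> W *v y \<and> q \<bullet> y \<le> r"
      then obtain y where "?a \<le> W *v y" "q \<bullet> y \<le> r" by blast
      then have "recourse q W T h x \<xi> \<le> ereal r"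
        unfolding recourse_def by (intro INF_lower2[of y]) auto
      with r(2) show False by simp
    qed
    then obtain p where "p \<in> lp_dual q W" "r < p \<bullet> ?a" using lp_strong_duality[OF p0] by blast
    then have "ereal r \<le> (SUP p\<in>lp_dual q W. ereal (p \<bullet> ?a))" by (intro SUP_upper2[of p]) auto
    with r(1) show False by simp
  qed
  show "(SUP p\<in>lp_dual q W. ereal (p \<bullet> ?a)) \<le> recourse q W T h x \<xi>"
    unfolding recourse_def by (auto intro!: SUP_least INF_greatest lp_weak_duality)
qed

text \<open>A supremum of continuous functions is lower semicontinuous: each strict superlevel set
  is a union of open sets, one per dual point, and openness survives arbitrary unions.\<close>

lemma borel_measurable_recourse [measurable]:
  assumes "sufficiently_expensive q W"
  shows "recourse q W T h x \<in> borel_measurable borel"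
  unfolding borel_measurable_ereal_iff_Ioi
proof
  fix a
  have "recourse q W T h x -` {a<..} = (\<Union>p\<in>lp_dual q W. {\<xi>. a < ereal (p \<bullet> (T x *v \<xi> + h x))})"
    by (auto simp: recourse_eq_SUP[OF assms] less_SUP_iff)
  also have "open \<dots>"
    by (intro open_UN ballI open_Collect_less continuous_intros)
  finally show "recourse q W T h x -` {a<..} \<inter> space borel \<in> sets borel"
    by simp
qed

section \<open>Expectations of extended-real functions\<close>

text \<open>Passing from \<open>g\<close> to \<open>f\<close> enlarges the positive part and shrinks
  the negative part. This allows the recourse function to be replaced by the value of one dual point
  per scenario.\<close>

lemma ereal_expectation_ge:
  assumes g: "integrable M g" and le: "\<And>x. ereal (g x) \<le> f x"
  shows "ereal (integral\<^sup>L M g) \<le> ereal_expectation M f"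
proof -
  let ?P = "\<integral>\<^sup>+ x. ennreal (g x) \<partial>M" and ?N = "\<integral>\<^sup>+ x. ennreal (- g x) \<partial>M"
  have fin: "?P \<noteq> \<infinity>" "?N \<noteq> \<infinity>" using g by (auto simp: real_integrable_def)
  have "ereal (integral\<^sup>L M g) = enn2ereal ?P - enn2ereal ?N"
    using fin by (cases ?P; cases ?N) (auto simp: real_lebesgue_integral_def[OF g])
  also have "\<dots> \<le> ereal_expectation M f"
    unfolding ereal_expectation_def
  proof (intro ereal_minus_mono)
    have "ennreal (g x) \<le> e2ennreal (f x)" for x using e2ennreal_mono[OF le[of x]] by simp
    then show "enn2ereal ?P \<le> enn2ereal (\<integral>\<^sup>+ x. e2ennreal (f x) \<partial>M)"
      by (simp add: nn_integral_mono flip: less_eq_ennreal.rep_eq)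
    have "e2ennreal (- f x) \<le> ennreal (- g x)" for x
      using e2ennreal_mono[of "- f x" "ereal (- g x)"] le[of x] ereal_minus_le_minus[of "f x" "ereal (g x)"] by simp
    then show "enn2ereal (\<integral>\<^sup>+ x. e2ennreal (- f x) \<partial>M) \<le> enn2ereal ?N"
      by (simp add: nn_integral_mono flip: less_eq_ennreal.rep_eq)
  qed
  finally show ?thesis .
qed

lemma ereal_expectation_ereal:
  assumes g: "integrable M g"
  shows "ereal_expectation M (\<lambda>x. ereal (g x)) = ereal (integral\<^sup>L M g)"
proof -
  let ?P = "\<integral>\<^sup>+ x. ennreal (g x) \<partial>M" and ?N = "\<integral>\<^sup>+ x. ennreal (- g x) \<partial>M"
  have fin: "?P \<noteq> \<infinity>" "?N \<noteq> \<infinity>" using g by (auto simp: real_integrable_def)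
  then show ?thesis
    by (cases ?P; cases ?N) (auto simp: ereal_expectation_def real_lebesgue_integral_def[OF g])
qed

section \<open>The asymmetric reference norm\<close>

text \<open>Comparison with the Euclidean norm, in which the first moments are required to be
  finite.\<close>

lemma ref_norm_le:
  fixes \<xi> :: "real ^ 'k"
  assumes "0 < wp" and "0 < wm"
  shows "ref_norm wp wm \<xi> \<le> (wp + wm) * real CARD('k) * norm \<xi>"
proof -
  have "max (wp * \<xi> $ k) (- wm * \<xi> $ k) \<le> (wp + wm) * norm \<xi>" for k
  proof -
    have "wp * \<xi> $ k \<le> wp * norm \<xi>" "- wm * \<xi> $ k \<le> wm * norm \<xi>" "0 \<le> wp * norm \<xi>" "0 \<le> wm * norm \<xi>"
      using assms component_le_norm_cart[of \<xi> k] mult_left_mono[of "- \<xi> $ k" "norm \<xi>" wm]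
      by (auto intro!: mult_left_mono)
    then show ?thesis by (simp add: distrib_right)
  qed
  then have "ref_norm wp wm \<xi> \<le> (\<Sum>k\<in>(UNIV::'k set). (wp + wm) * norm \<xi>)"
    unfolding ref_norm_def by (rule sum_mono)
  then show ?thesis by (simp add: ac_simps)
qed

lemma ref_norm_nonneg:
  assumes "0 < wp" and "0 < wm"
  shows "0 \<le> ref_norm wp wm \<xi>"
  unfolding ref_norm_def
proof (rule sum_nonneg)
  fix k
  show "0 \<le> max (wp * \<xi> $ k) (- wm * \<xi> $ k)"
    using assms by (cases "0 \<le> \<xi> $ k") (auto simp: le_max_iff_disj mult_nonneg_nonpos)
qed

text \<open>Homogeneity is restricted to nonnegative factors because for
  \<open>wp \<noteq> wm\<close> the function is not even.\<close>

lemma ref_norm_scale: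
  assumes "0 \<le> t"
  shows "ref_norm wp wm (t *\<^sub>R \<xi>) = t * ref_norm wp wm \<xi>"
proof -
  have "max (wp * (t * a)) (- (wm * (t * a))) = t * max (wp * a) (- (wm * a))" for a
    using assms by (simp add: max_mult_distrib_left algebra_simps)
  then show ?thesis by (simp add: ref_norm_def sum_distrib_left)
qed

lemma borel_measurable_ref_dist [measurable]:
  "(\<lambda>z. ref_dist wp wm (fst z) (snd z)) \<in> borel_measurable (borel \<Otimes>\<^sub>M borel :: ((real ^ 'k) \<times> (real ^ 'k)) measure)"
  unfolding borel_prod ref_dist_def ref_norm_def
  by (intro borel_measurable_continuous_onI continuous_intros)

section \<open>Upper bounds on expectations over the Wasserstein ball\<close>

text \<open>Comparing \<open>v\<close> with its value at 0 gives linear growth. The upper and lower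
  bounds use the two orders of the arguments of the asymmetric distance.\<close>

lemma integrable_finite_moment:
  fixes v :: "real ^ 'k \<Rightarrow> real"
  assumes w: "0 < wp" "0 < wm"
    and P: "P \<in> finite_moment_distrs" and [measurable]: "v \<in> borel_measurable borel"
    and lip: "\<And>\<xi> \<xi>'. v \<xi> \<le> v \<xi>' + l * ref_dist wp wm \<xi> \<xi>'" and l: "0 \<le> l"
  shows "integrable P v"
proof -
  interpret prob_space P using P by (simp add: finite_moment_distrs_def)
  have sets [measurable_cong]: "sets P = sets borel" and int: "integrable P norm"
    using P by (auto simp: finite_moment_distrs_def)
  let ?C = "(wp + wm) * real CARD('k)"
  have bound: "\<bar>v \<xi>\<bar> \<le> \<bar>v 0\<bar> + l * ?C * norm \<xi>" for \<xi>
  proof -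
    have "l * ref_dist wp wm \<xi> 0 \<le> l * (?C * norm \<xi>)" "l * ref_dist wp wm 0 \<xi> \<le> l * (?C * norm \<xi>)"
      using ref_norm_le[OF w, of \<xi>] ref_norm_le[OF w, of "- \<xi>"] l
      by (auto simp: ref_dist_def intro!: mult_left_mono)
    then show ?thesis using lip[of \<xi> 0] lip[of 0 \<xi>] by (simp add: mult.assoc abs_if)
  qed
  show ?thesis
  proof (rule Bochner_Integration.integrable_bound)
    show "integrable P (\<lambda>\<xi>. \<bar>v 0\<bar> + l * ?C * norm \<xi>)" using int by simp
    show "AE \<xi> in P. norm (v \<xi>) \<le> norm (\<bar>v 0\<bar> + l * ?C * norm \<xi>)"
    proof (rule AE_I2)
      fix \<xi> show "norm (v \<xi>) \<le> norm (\<bar>v 0\<bar> + l * ?C * norm \<xi>)"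
        using bound[of \<xi>] by simp
    qed
  qed simp
qed

text \<open>The easy half of Kantorovich duality: the Lipschitz inequality is integrated against a
  coupling. A nearly optimal coupling is enough, at the price of an arbitrary error
  \<open>e\<close>.\<close>

lemma wasserstein_ball_integral_le:
  fixes v :: "real ^ 'k \<Rightarrow> real"
  assumes w: "0 < wp" "0 < wm" and P: "P \<in> wasserstein_ball (ref_dist wp wm) \<epsilon> P0"
    and P0: "P0 \<in> finite_moment_distrs" and [measurable]: "v \<in> borel_measurable borel"
    and lip: "\<And>\<xi> \<xi>'. v \<xi> \<le> v \<xi>' + l * ref_dist wp wm \<xi> \<xi>'" and l: "0 \<le> l" and \<epsilon>: "0 \<le> \<epsilon>"
  shows "integral\<^sup>L P v \<le> integral\<^sup>L P0 v + l * \<epsilon>"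
proof (rule field_le_epsilon)
  fix e :: real assume e: "0 < e"
  let ?d = "\<lambda>z :: (real ^ 'k) \<times> (real ^ 'k). ref_dist wp wm (fst z) (snd z)"
  \<comment> \<open>The summand 1 keeps the denominator positive when \<open>l = 0\<close>.\<close>
  define \<delta> where "\<delta> = e / (l + 1)"
  have \<delta>: "0 < \<delta>" "l * \<delta> \<le> e" using e l by (auto simp: \<delta>_def field_simps)
  have Pf: "P \<in> finite_moment_distrs" and W: "wasserstein1 (ref_dist wp wm) P P0 \<le> ennreal \<epsilon>"
    using P by (auto simp: wasserstein_ball_def)
  have "wasserstein1 (ref_dist wp wm) P P0 < ennreal (\<epsilon> + \<delta>)"
    using \<delta> \<epsilon> by (intro le_less_trans[OF W] ennreal_lessI) auto
  then obtain Q where Q: "Q \<in> couplings P P0" and cost: "(\<integral>\<^sup>+ z. ennreal (?d z) \<partial>Q) < ennreal (\<epsilon> + \<delta>)"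
    by (auto simp: wasserstein1_def INF_less_iff)
  have sQ [measurable_cong]: "sets Q = sets (borel \<Otimes>\<^sub>M borel)"
    and dQ: "distr Q borel fst = P" "distr Q borel snd = P0"
    using Q by (auto simp: couplings_def)
  have nonneg: "0 \<le> ?d z" for z using ref_norm_nonneg[OF w] by (simp add: ref_dist_def)
  have dint: "integrable Q ?d"
    using cost nonneg by (intro integrableI_nonneg) (auto intro: less_le_trans)
  have dle: "integral\<^sup>L Q ?d \<le> \<epsilon> + \<delta>"
    using cost nonneg \<epsilon> \<delta> nn_integral_eq_integral[OF dint] by (simp add: ennreal_less_iff del: ennreal_plus)
  have vint: "integrable P v" "integrable P0 v"
    by (rule integrable_finite_moment[OF w _ _ lip l]; fact assms Pf)+
  have iv: "integrable Q (\<lambda>z. v (fst z))" "integrable Q (\<lambda>z. v (snd z))"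
    using vint unfolding dQ[symmetric] by (auto simp: integrable_distr_eq)
  have "integral\<^sup>L P v = (\<integral>z. v (fst z) \<partial>Q)" unfolding dQ(1)[symmetric] by (simp add: integral_distr)
  also have "\<dots> \<le> (\<integral>z. v (snd z) + l * ?d z \<partial>Q)"
    using iv dint lip by (intro integral_mono) auto
  also have "\<dots> = (\<integral>z. v (snd z) \<partial>Q) + l * integral\<^sup>L Q ?d" using iv dint by simp
  also have "(\<integral>z. v (snd z) \<partial>Q) = integral\<^sup>L P0 v" unfolding dQ(2)[symmetric] by (simp add: integral_distr)
  also have "l * integral\<^sup>L Q ?d \<le> l * (\<epsilon> + \<delta>)" using dle l by (rule mult_left_mono)
  finally show "integral\<^sup>L P v \<le> integral\<^sup>L P0 v + l * \<epsilon> + e"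
    using \<delta>(2) by (simp add: distrib_left)
qed

section \<open>Finitely supported and empirical distributions\<close>

lemma finite_pmf_finite_moment:
  assumes "finite (set_pmf \<mu>)"
  shows "distr (measure_pmf \<mu>) borel f \<in> finite_moment_distrs"
  using assms
  by (auto simp: finite_moment_distrs_def integrable_distr_eq
      intro!: integrable_measure_pmf_finite measure_pmf.prob_space_distr)

text \<open>Two random vectors on the same finite probability space are coupled by their joint law,
  whose transport cost is the mean distance. The moved vector \<open>f\<close> stands first, as in
  \<open>wasserstein_ball\<close>.\<close>

lemma finite_pmf_in_wasserstein_ball:
  assumes w: "0 < wp" "0 < wm" and fin: "finite (set_pmf \<mu>)"
    and cost: "(\<integral>\<omega>. ref_dist wp wm (f \<omega>) (g \<omega>) \<partial>measure_pmf \<mu>) \<le> \<epsilon>"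
  shows "distr (measure_pmf \<mu>) borel f \<in>
    wasserstein_ball (ref_dist wp wm) \<epsilon> (distr (measure_pmf \<mu>) borel g)"
proof -
  let ?Q = "distr (measure_pmf \<mu>) (borel \<Otimes>\<^sub>M borel) (\<lambda>\<omega>. (f \<omega>, g \<omega>))"
  have meas: "(\<lambda>\<omega>. (f \<omega>, g \<omega>)) \<in> measure_pmf \<mu> \<rightarrow>\<^sub>M borel \<Otimes>\<^sub>M borel"
    by (intro measurable_Pair) auto
  have nonneg: "0 \<le> ref_dist wp wm \<xi> \<xi>'" for \<xi> \<xi>' :: "real ^ 'b"
    using ref_norm_nonneg[OF w] by (simp add: ref_dist_def)
  have "?Q \<in> couplings (distr (measure_pmf \<mu>) borel f) (distr (measure_pmf \<mu>) borel g)"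
    using meas by (auto simp: couplings_def distr_distr o_def intro!: measure_pmf.prob_space_distr)
  then have "wasserstein1 (ref_dist wp wm) (distr (measure_pmf \<mu>) borel f) (distr (measure_pmf \<mu>) borel g)
    \<le> (\<integral>\<^sup>+ z. ennreal (ref_dist wp wm (fst z) (snd z)) \<partial>?Q)"
    unfolding wasserstein1_def by (rule INF_lower)
  also have "\<dots> = (\<integral>\<^sup>+ \<omega>. ennreal (ref_dist wp wm (f \<omega>) (g \<omega>)) \<partial>measure_pmf \<mu>)"
    using meas by (subst nn_integral_distr) auto
  also have "\<dots> = ennreal (\<integral>\<omega>. ref_dist wp wm (f \<omega>) (g \<omega>) \<partial>measure_pmf \<mu>)"
    using nonneg fin by (intro nn_integral_eq_integral integrable_measure_pmf_finite) auto
  also have "\<dots> \<le> ennreal \<epsilon>" using cost by (rule ennreal_leI)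
  finally show ?thesis using finite_pmf_finite_moment[OF fin] by (simp add: wasserstein_ball_def)
qed

lemma empirical_eq_pmf:
  assumes "1 \<le> n"
  shows "empirical n s = distr (measure_pmf (pmf_of_set {1..n})) borel s"
proof (rule measure_eqI)
  show "sets (empirical n s) = sets (distr (measure_pmf (pmf_of_set {1..n})) borel s)"
    by (simp add: empirical_def)
next
  fix A assume "A \<in> sets (empirical n s)"
  then have A: "A \<in> sets borel" by (simp add: empirical_def)
  have "(\<Sum>i = 1..n. indicator A (s i)) = real (card ({1..n} \<inter> s -` A))"
    by (simp add: indicator_def sum.If_cases vimage_def)
  with A assms show "emeasure (empirical n s) A =
    emeasure (distr (measure_pmf (pmf_of_set {1..n})) borel s) A"
    by (simp add: emeasure_empirical emeasure_distr emeasure_pmf_of_set)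
qed

lemma integral_empirical:
  fixes v :: "real ^ 'k \<Rightarrow> real"
  assumes "1 \<le> n" and "v \<in> borel_measurable borel"
  shows "integral\<^sup>L (empirical n s) v = 1 / real n * (\<Sum>i = 1..n. v (s i))"
  using assms by (simp add: empirical_eq_pmf integral_distr integral_pmf_of_set)

lemma empirical_finite_moment:
  assumes "1 \<le> n"
  shows "empirical n s \<in> finite_moment_distrs"
  using assms by (simp add: empirical_eq_pmf finite_pmf_finite_moment)

section \<open>Lower bounds by moving a small fraction of the mass\<close>

text \<open>The scenario space of the perturbation: the first component draws a sample index, the
  second decides whether that sample is moved.\<close>

lemma integral_uniform_bernoulli:
  fixes G :: "nat \<times> bool \<Rightarrow> real"
  assumes "1 \<le> n" and "0 \<le> \<beta>" and "\<beta> \<le> 1"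
  shows "(\<integral>\<omega>. G \<omega> \<partial>measure_pmf (pair_pmf (pmf_of_set {1..n}) (bernoulli_pmf \<beta>))) =
    1 / real n * (\<Sum>i = 1..n. \<beta> * G (i, True) + (1 - \<beta>) * G (i, False))"
proof -
  have "(\<integral>\<omega>. G \<omega> \<partial>measure_pmf (pair_pmf (pmf_of_set {1..n}) (bernoulli_pmf \<beta>))) =
    (\<Sum>\<omega>\<in>{1..n} \<times> UNIV. pmf (pair_pmf (pmf_of_set {1..n}) (bernoulli_pmf \<beta>)) \<omega> *\<^sub>R G \<omega>)"
    using assms by (intro integral_measure_pmf) auto
  also have "\<dots> = (\<Sum>i = 1..n. \<Sum>b\<in>UNIV. pmf (pair_pmf (pmf_of_set {1..n}) (bernoulli_pmf \<beta>)) (i, b) * G (i, b))"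
    by (simp add: sum.cartesian_product)
  also have "\<dots> = (\<Sum>i = 1..n. 1 / real n * (\<beta> * G (i, True) + (1 - \<beta>) * G (i, False)))"
    using assms by (intro sum.cong) (auto simp: pmf_pair UNIV_bool field_simps)
  finally show ?thesis by (simp add: sum_distrib_left)
qed

text \<open>The distribution that moves every sample \<open>s i\<close> by \<open>(\<epsilon> / \<beta>) *\<^sub>R v\<close> with probability \<open>\<beta>\<close> has
  transport cost at most \<open>\<epsilon>\<close>; its gain is \<open>\<epsilon>\<close> times the slope in the direction \<open>v\<close> plus an
  error that vanishes as \<open>\<beta> \<rightarrow> 0\<close>.\<close>

lemma worst_case_ge_perturbed:
  assumes rec: "sufficiently_expensive q W" and w: "0 < wp" "0 < wm" and \<epsilon>: "0 < \<epsilon>" and n: "1 \<le> n"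
    and \<pi>: "\<And>i. \<pi> i \<in> lp_dual q W" and p: "p \<in> lp_dual q W" and v: "ref_norm wp wm v \<le> 1"
    and \<beta>: "0 < \<beta>" "\<beta> \<le> 1"
  shows "ereal (1 / real n * (\<Sum>i = 1..n. \<beta> * (p \<bullet> (T x *v s i + h x))
      + (1 - \<beta>) * (\<pi> i \<bullet> (T x *v s i + h x))) + \<epsilon> * (p \<bullet> (T x *v v)))
    \<le> worst_case q W T h wp wm \<epsilon> n s x"
proof -
  define \<mu> where "\<mu> = pair_pmf (pmf_of_set {1..n}) (bernoulli_pmf \<beta>)"
  define f where "f = (\<lambda>\<omega>. s (fst \<omega>) + (if snd \<omega> then (\<epsilon> / \<beta>) *\<^sub>R v else 0))"
  \<comment> \<open>\<open>G\<close> uses the dual point \<open>p\<close> for moved mass and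
    \<open>\<pi> i\<close> for mass left at \<open>s i\<close>, so it lies below the recourse
    value.\<close>
  define G where "G = (\<lambda>\<omega>. (if snd \<omega> then p else \<pi> (fst \<omega>)) \<bullet> (T x *v f \<omega> + h x))"
  have fin: "finite (set_pmf \<mu>)" using n by (simp add: \<mu>_def)
  note int = integral_uniform_bernoulli[OF n less_imp_le[OF \<beta>(1)] \<beta>(2), folded \<mu>_def]
  have "(\<integral>\<omega>. ref_dist wp wm (f \<omega>) (s (fst \<omega>)) \<partial>measure_pmf \<mu>) = \<epsilon> * ref_norm wp wm v"
    using n \<beta> \<epsilon> by (simp add: int f_def ref_dist_def ref_norm_scale) (simp add: ref_norm_def)
  also have "\<dots> \<le> \<epsilon>" using v \<epsilon> by (simp add: mult_left_le)
  finally have "distr (measure_pmf \<mu>) borel f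
      \<in> wasserstein_ball (ref_dist wp wm) \<epsilon> (distr (measure_pmf \<mu>) borel (\<lambda>\<omega>. s (fst \<omega>)))"
    by (rule finite_pmf_in_wasserstein_ball[OF w fin])
  also have "distr (measure_pmf \<mu>) borel (\<lambda>\<omega>. s (fst \<omega>)) = distr (measure_pmf (map_pmf fst \<mu>)) borel s"
    by (simp add: map_pmf_rep_eq distr_distr o_def)
  also have "\<dots> = empirical n s" by (simp add: \<mu>_def map_fst_pair_pmf empirical_eq_pmf[OF n])
  finally have ball: "distr (measure_pmf \<mu>) borel f \<in> wasserstein_ball (ref_dist wp wm) \<epsilon> (empirical n s)" .
  \<comment> \<open>The factor \<open>\<epsilon> / \<beta>\<close> is met with probability
    \<open>\<beta>\<close>, so the slope contributes
    \<open>\<epsilon> * (p \<bullet> (T x *v v))\<close> for every \<open>\<beta>\<close>.\<close>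
  have "p \<bullet> (T x *v (s i + (\<epsilon> / \<beta>) *\<^sub>R v) + h x) = p \<bullet> (T x *v s i + h x) + \<epsilon> / \<beta> * (p \<bullet> (T x *v v))" for i
    by (simp add: matrix_vector_right_distrib matrix_vector_mult_scaleR inner_add_right)
  then have "ereal (1 / real n * (\<Sum>i = 1..n. \<beta> * (p \<bullet> (T x *v s i + h x))
      + (1 - \<beta>) * (\<pi> i \<bullet> (T x *v s i + h x))) + \<epsilon> * (p \<bullet> (T x *v v))) = ereal (integral\<^sup>L (measure_pmf \<mu>) G)"
    using n \<beta> by (simp add: int G_def f_def distrib_left sum.distrib)
  also have "\<dots> \<le> ereal_expectation (measure_pmf \<mu>) (\<lambda>\<omega>. recourse q W T h x (f \<omega>))"
  proof (rule ereal_expectation_ge)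
    show "integrable (measure_pmf \<mu>) G" by (rule integrable_measure_pmf_finite[OF fin])
    show "ereal (G \<omega>) \<le> recourse q W T h x (f \<omega>)" for \<omega>
      unfolding recourse_eq_SUP[OF rec] G_def using \<pi> p by (intro SUP_upper) auto
  qed
  also have "\<dots> = ereal_expectation (distr (measure_pmf \<mu>) borel f) (recourse q W T h x)"
    using borel_measurable_recourse[OF rec, of T h x] unfolding ereal_expectation_def
    by (subst (1 2) nn_integral_distr) auto
  also have "\<dots> \<le> worst_case q W T h wp wm \<epsilon> n s x"
    unfolding worst_case_def by (rule SUP_upper[OF ball])
  finally show ?thesis .
qed

text \<open>The limit \<open>\<beta> \<rightarrow> 0\<close> from the right in the perturbed bound:
  the weight of \<open>p\<close> at the samples vanishes, while the slope term is constant in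
  \<open>\<beta>\<close>.\<close>

lemma worst_case_ge:
  assumes rec: "sufficiently_expensive q W" and w: "0 < wp" "0 < wm" and \<epsilon>: "0 < \<epsilon>" and n: "1 \<le> n"
    and \<pi>: "\<And>i. \<pi> i \<in> lp_dual q W" and p: "p \<in> lp_dual q W" and v: "ref_norm wp wm v \<le> 1"
  shows "ereal (1 / real n * (\<Sum>i = 1..n. \<pi> i \<bullet> (T x *v s i + h x)) + \<epsilon> * (p \<bullet> (T x *v v)))
    \<le> worst_case q W T h wp wm \<epsilon> n s x"
proof -
  let ?g = "\<lambda>\<beta>. 1 / real n * (\<Sum>i = 1..n. \<beta> * (p \<bullet> (T x *v s i + h x))
      + (1 - \<beta>) * (\<pi> i \<bullet> (T x *v s i + h x))) + \<epsilon> * (p \<bullet> (T x *v v))"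
  have "(?g \<longlongrightarrow> ?g 0) (at_right 0)" by (intro tendsto_intros)
  then have "((\<lambda>\<beta>. ereal (?g \<beta>)) \<longlongrightarrow> ereal (?g 0)) (at_right 0)" by (rule tendsto_ereal)
  moreover have "\<forall>\<^sub>F \<beta> in at_right 0. ereal (?g \<beta>) \<le> worst_case q W T h wp wm \<epsilon> n s x"
    using eventually_at_right_real[OF zero_less_one]
    by eventually_elim (rule worst_case_ge_perturbed[OF rec w \<epsilon> n \<pi> p v], simp_all)
  ultimately have "ereal (?g 0) \<le> worst_case q W T h wp wm \<epsilon> n s x"
    by (intro tendsto_upperbound) auto
  then show ?thesis by simp
qed

section \<open>Feasible decisions from a finite worst case\<close>

lemma ref_norm_axis:
  fixes k :: "'k::finite"
  assumes "0 < wp" and "0 < wm"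
  shows "ref_norm wp wm ((1 / wp) *\<^sub>R axis k 1 :: real ^ 'k) = 1"
    and "ref_norm wp wm (- ((1 / wm) *\<^sub>R axis k 1) :: real ^ 'k) = 1"
proof -
  have "ref_norm wp wm ((1 / wp) *\<^sub>R axis k 1 :: real ^ 'k) = (\<Sum>j\<in>UNIV. if j = k then 1 else 0)"
    using assms unfolding ref_norm_def by (intro sum.cong) (auto simp: axis_def max_def field_simps)
  then show "ref_norm wp wm ((1 / wp) *\<^sub>R axis k 1 :: real ^ 'k) = 1" by simp
  have "ref_norm wp wm (- ((1 / wm) *\<^sub>R axis k 1) :: real ^ 'k) = (\<Sum>j\<in>UNIV. if j = k then 1 else 0)"
    using assms unfolding ref_norm_def by (intro sum.cong) (auto simp: axis_def max_def field_simps)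
  then show "ref_norm wp wm (- ((1 / wm) *\<^sub>R axis k 1) :: real ^ 'k) = 1" by simp
qed

text \<open>The points \<open>\<pi> i\<close> are chosen independently of each other, so
  near-maximizers of the single summands combine into one admissible choice.\<close>

lemma sum_SUP_le:
  fixes f :: "'i \<Rightarrow> 'a \<Rightarrow> real"
  assumes "finite I" and D: "D \<noteq> {}"
    and bound: "\<And>\<pi>. (\<And>i. \<pi> i \<in> D) \<Longrightarrow> (\<Sum>i\<in>I. f i (\<pi> i)) \<le> R"
  shows "(\<Sum>i\<in>I. SUP p\<in>D. f i p) \<le> R"
proof (rule field_le_epsilon)
  fix e :: real assume e: "0 < e"
  define \<delta> where "\<delta> = e / (real (card I) + 1)"
  have \<delta>: "0 < \<delta>" "real (card I) * \<delta> \<le> e" using e by (auto simp: \<delta>_def field_simps)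
  have "\<exists>p\<in>D. (SUP p\<in>D. f i p) - \<delta> < f i p" for i
    using less_cSupD[of "f i ` D" "(SUP p\<in>D. f i p) - \<delta>"] D \<delta>(1) by auto
  then obtain \<pi> where \<pi>: "\<And>i. \<pi> i \<in> D" "\<And>i. (SUP p\<in>D. f i p) - \<delta> < f i (\<pi> i)" by metis
  have "(\<Sum>i\<in>I. SUP p\<in>D. f i p) \<le> (\<Sum>i\<in>I. f i (\<pi> i) + \<delta>)"
    using \<pi>(2) by (intro sum_mono) (simp add: less_imp_le diff_less_eq)
  also have "\<dots> = (\<Sum>i\<in>I. f i (\<pi> i)) + real (card I) * \<delta>" by (simp add: sum.distrib)
  also have "\<dots> \<le> R + e" using bound[OF \<pi>(1)] \<delta>(2) by (rule add_mono)
  finally show "(\<Sum>i\<in>I. SUP p\<in>D. f i p) \<le> R + e" .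
qed

text \<open>For a finite worst case \<open>R\<close>, duality supplies every decision: each
  \<open>y i\<close> costs at most the dual supremum \<open>V i\<close> at its sample, and
  \<open>\<phi>\<close>, \<open>\<psi>\<close> come from the right-hand sides
  \<open>T x *v v\<close> for directions of reference norm 1. An infinite worst case is
  trivial.\<close>

lemma lp_value_le_worst_case:
  fixes T :: "real ^ 'n1 \<Rightarrow> real ^ 'k ^ 'm"
  assumes rec: "sufficiently_expensive q W" and w: "0 < wp" "0 < wm" and \<epsilon>: "0 < \<epsilon>" and n: "1 \<le> n"
    and x: "x \<in> X"
  shows "(INF (l, y, \<phi>, \<psi>) \<in> {(l, y, \<phi>, \<psi>). lp_feasible X q W T h wp wm n s x l y \<phi> \<psi>}.
      ereal (lp_objective c q \<epsilon> n x l y)) \<le> ereal (c \<bullet> x) + worst_case q W T h wp wm \<epsilon> n s x"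
proof (cases "worst_case q W T h wp wm \<epsilon> n s x")
  case (real R)
  obtain p0 where p0: "p0 \<in> lp_dual q W"
    using rec by (auto simp: sufficiently_expensive_def lp_dual_def)
  define a where "a = (\<lambda>i. T x *v s i + h x)"
  have bound: "1 / real n * (\<Sum>i = 1..n. \<pi> i \<bullet> a i) + \<epsilon> * (p \<bullet> (T x *v v)) \<le> R"
    if "\<And>i. \<pi> i \<in> lp_dual q W" "p \<in> lp_dual q W" "ref_norm wp wm v \<le> 1" for \<pi> p v
    using worst_case_ge[OF rec w \<epsilon> n that, where T = T and x = x and s = s and h = h] real by (simp add: a_def)
  have bound0: "1 / real n * (\<Sum>i = 1..n. \<pi> i \<bullet> a i) \<le> R" if "\<And>i. \<pi> i \<in> lp_dual q W" for \<pi>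
    using bound[OF that p0, of 0] by (simp add: ref_norm_def)
  define V where "V = (\<lambda>i. SUP p\<in>lp_dual q W. p \<bullet> a i)"
  have le_V: "p \<bullet> a i \<le> V i" if i: "i \<in> {1..n}" and p: "p \<in> lp_dual q W" for i p
    unfolding V_def
  proof (rule cSUP_upper[OF p bdd_aboveI2])
    fix p assume p: "p \<in> lp_dual q W"
    \<comment> \<open>Fixing \<open>p0\<close> at all other samples isolates the \<open>i\<close>-th
      dual value and bounds it, so the real supremum \<open>V i\<close> is meaningful.\<close>
    have "1 / real n * (\<Sum>j = 1..n. (if j = i then p else p0) \<bullet> a j) \<le> R"
      by (rule bound0) (use p p0 in auto)
    moreover have "(\<Sum>j = 1..n. (if j = i then p else p0) \<bullet> a j) = p \<bullet> a i + (\<Sum>j\<in>{1..n} - {i}. p0 \<bullet> a j)"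
      using i by (subst sum.remove[of _ i]) auto
    ultimately show "p \<bullet> a i \<le> real n * R - (\<Sum>j\<in>{1..n} - {i}. p0 \<bullet> a j)"
      using n by (simp add: field_simps)
  qed
  have "\<exists>y. a i \<le> W *v y \<and> q \<bullet> y \<le> V i" if "i \<in> {1..n}" for i
    using lp_strong_duality[OF p0, of "a i" "V i"] le_V[OF that] by force
  then obtain y where y: "\<And>i. i \<in> {1..n} \<Longrightarrow> a i \<le> W *v y i" "\<And>i. i \<in> {1..n} \<Longrightarrow> q \<bullet> y i \<le> V i"
    by metis
  \<comment> \<open>The excess of \<open>R\<close> over the mean of the dual suprema, per unit of
    radius; this makes the objective at most \<open>c \<bullet> x + R\<close>.\<close>
  define l where "l = (R - 1 / real n * (\<Sum>i = 1..n. V i)) / \<epsilon>"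
  have slope: "p \<bullet> (T x *v v) \<le> l" if p: "p \<in> lp_dual q W" and v: "ref_norm wp wm v \<le> 1" for p v
  proof -
    \<comment> \<open>The right-hand side does not depend on \<open>\<pi>\<close>, so the supremum
      over all choices of \<open>\<pi>\<close> may be taken on the left.\<close>
    have "(\<Sum>i = 1..n. \<pi> i \<bullet> a i) \<le> real n * (R - \<epsilon> * (p \<bullet> (T x *v v)))"
      if "\<And>i. \<pi> i \<in> lp_dual q W" for \<pi>
      using bound[OF that p v] n by (simp add: field_simps)
    then have "(\<Sum>i = 1..n. V i) \<le> real n * (R - \<epsilon> * (p \<bullet> (T x *v v)))"
      unfolding V_def using p0 by (intro sum_SUP_le) auto
    then show ?thesis using n \<epsilon> by (simp add: l_def field_simps)
  qed
  have l: "0 \<le> l" using slope[OF p0, of 0] by (simp add: ref_norm_def)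
  have recession: "\<exists>\<phi>. T x *v v \<le> W *v \<phi> \<and> q \<bullet> \<phi> \<le> l" if "ref_norm wp wm v \<le> 1" for v
    using lp_strong_duality[OF p0, of "T x *v v" l] slope[OF _ that] by force
  have "\<exists>\<phi>. T x *v ((1 / wp) *\<^sub>R axis k 1) \<le> W *v \<phi> \<and> q \<bullet> \<phi> \<le> l" for k :: 'k
    by (rule recession) (simp add: ref_norm_axis[OF w])
  then obtain \<phi> where \<phi>: "\<And>k. (1 / wp) *\<^sub>R (T x *v axis k 1) \<le> W *v \<phi> k" "\<And>k. q \<bullet> \<phi> k \<le> l"
    unfolding matrix_vector_mult_scaleR by metis
  have "\<exists>\<psi>. T x *v - ((1 / wm) *\<^sub>R axis k 1) \<le> W *v \<psi> \<and> q \<bullet> \<psi> \<le> l" for k :: 'k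
    by (rule recession) (simp add: ref_norm_axis[OF w])
  then obtain \<psi> where \<psi>: "\<And>k. - ((1 / wm) *\<^sub>R (T x *v axis k 1)) \<le> W *v \<psi> k" "\<And>k. q \<bullet> \<psi> k \<le> l"
    unfolding matrix_vector_mult_scaleR linear_neg[OF matrix_vector_mul_linear] by metis
  have feas: "lp_feasible X q W T h wp wm n s x l y \<phi> \<psi>"
    using x l y(1) \<phi> \<psi> by (auto simp: lp_feasible_def a_def)
  have "(\<Sum>i = 1..n. q \<bullet> y i) \<le> (\<Sum>i = 1..n. V i)" by (rule sum_mono) (rule y(2))
  then have "1 / real n * (\<Sum>i = 1..n. q \<bullet> y i) \<le> 1 / real n * (\<Sum>i = 1..n. V i)"
    by (rule mult_left_mono) simp
  moreover have "\<epsilon> * l = R - 1 / real n * (\<Sum>i = 1..n. V i)" using \<epsilon> by (simp add: l_def)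
  ultimately have "lp_objective c q \<epsilon> n x l y \<le> c \<bullet> x + R" unfolding lp_objective_def by linarith
  with feas show ?thesis unfolding real by (intro INF_lower2[of "(l, y, \<phi>, \<psi>)"]) auto
next
  case MInf
  obtain p0 where "p0 \<in> lp_dual q W"
    using rec by (auto simp: sufficiently_expensive_def lp_dual_def)
  then show ?thesis
    \<comment> \<open>The zero direction and one fixed dual point give a real lower bound, which
      excludes the value \<open>-\<infinity>\<close>.\<close>
    using worst_case_ge[OF rec w \<epsilon> n, where \<pi> = "\<lambda>_. p0" and p = p0 and v = 0 and T = T and x = x and s = s and h = h] MInf by (simp add: ref_norm_def)
qed simp

section \<open>Bounding the worst case by a feasible objective\<close>

text \<open>By weak duality \<open>\<phi> k\<close> bounds the slope along \<open>axis k 1\<close>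
  by \<open>l * wp\<close>, and \<open>\<psi> k\<close> bounds the slope along its negative by
  \<open>l * wm\<close>. The sign of \<open>\<delta> $ k\<close> selects the relevant bound, and the
  coordinates are summed.\<close>

lemma dual_slope_le:
  assumes w: "0 < wp" "0 < wm" and feas: "lp_feasible X q W T h wp wm n s x l y \<phi> \<psi>"
    and p: "p \<in> lp_dual q W"
  shows "p \<bullet> (T x *v \<delta>) \<le> l * ref_norm wp wm \<delta>"
proof -
  let ?t = "\<lambda>k. p \<bullet> (T x *v axis k 1)"
  have l: "0 \<le> l" using feas by (simp add: lp_feasible_def)
  have "\<delta> $ k * ?t k \<le> l * max (wp * \<delta> $ k) (- wm * \<delta> $ k)" for k
  proof -
    have "p \<bullet> ((1 / wp) *\<^sub>R (T x *v axis k 1)) \<le> q \<bullet> \<phi> k"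
      "p \<bullet> - ((1 / wm) *\<^sub>R (T x *v axis k 1)) \<le> q \<bullet> \<psi> k"
      by (rule lp_weak_duality[OF p]; use feas in \<open>simp add: lp_feasible_def\<close>)+
    moreover have "q \<bullet> \<phi> k \<le> l" "q \<bullet> \<psi> k \<le> l"
      using feas by (simp_all add: lp_feasible_def)
    ultimately have "?t k / wp \<le> l" "- ?t k / wm \<le> l" by auto
    then have t: "?t k \<le> l * wp" "- ?t k \<le> l * wm"
      using w pos_divide_le_eq[of wp "?t k" l] pos_divide_le_eq[of wm "- ?t k" l] by auto
    show ?thesis
    proof (cases "0 \<le> \<delta> $ k")
      case True
      have "\<delta> $ k * ?t k \<le> \<delta> $ k * (l * wp)" using True t by (intro mult_left_mono) auto
      also have "\<dots> = l * (wp * \<delta> $ k)" by simp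
      also have "\<dots> \<le> l * max (wp * \<delta> $ k) (- wm * \<delta> $ k)" using l by (intro mult_left_mono) auto
      finally show ?thesis .
    next
      case False
      have "- \<delta> $ k * - ?t k \<le> - \<delta> $ k * (l * wm)" using False t by (intro mult_left_mono) auto
      then have "\<delta> $ k * ?t k \<le> l * (- wm * \<delta> $ k)" by (simp add: algebra_simps)
      also have "\<dots> \<le> l * max (wp * \<delta> $ k) (- wm * \<delta> $ k)" using l by (intro mult_left_mono) auto
      finally show ?thesis .
    qed
  qed
  then have "(\<Sum>k\<in>UNIV. \<delta> $ k * ?t k) \<le> (\<Sum>k\<in>UNIV. l * max (wp * \<delta> $ k) (- wm * \<delta> $ k))"
    by (intro sum_mono)
  moreover have "p \<bullet> (T x *v \<delta>) = (\<Sum>k\<in>UNIV. \<delta> $ k * ?t k)"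
    by (simp add: matrix_mult_sum[of "T x" \<delta>] matrix_vector_mult_basis inner_sum_right scalar_mult_eq_scaleR)
  ultimately show ?thesis by (simp add: ref_norm_def sum_distrib_left)
qed

text \<open>Uniformly bounded dual slopes make their supremum Lipschitz with constant
  \<open>l\<close>. Feasibility at one sample then makes the recourse function finite everywhere, so
  the transport bound applies to its real version \<open>v\<close>.\<close>

lemma worst_case_le_objective:
  fixes s :: "nat \<Rightarrow> real ^ 'k"
  assumes rec: "sufficiently_expensive q W" and w: "0 < wp" "0 < wm" and \<epsilon>: "0 < \<epsilon>" and n: "1 \<le> n"
    and feas: "lp_feasible X q W T h wp wm n s x l y \<phi> \<psi>"
  shows "ereal (c \<bullet> x) + worst_case q W T h wp wm \<epsilon> n s x \<le> ereal (lp_objective c q \<epsilon> n x l y)"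
proof -
  let ?Z = "recourse q W T h x"
  obtain p0 where p0: "p0 \<in> lp_dual q W"
    using rec by (auto simp: sufficiently_expensive_def lp_dual_def)
  have l: "0 \<le> l" using feas by (simp add: lp_feasible_def)
  have lipZ: "?Z \<xi> \<le> ?Z \<xi>' + ereal (l * ref_dist wp wm \<xi> \<xi>')" for \<xi> \<xi>'
    unfolding recourse_eq_SUP[OF rec, of _ _ _ \<xi>]
  proof (rule SUP_least)
    fix p assume p: "p \<in> lp_dual q W"
    have "p \<bullet> (T x *v \<xi> + h x) = p \<bullet> (T x *v \<xi>' + h x) + p \<bullet> (T x *v (\<xi> - \<xi>'))"
      by (simp add: matrix_vector_mult_diff_distrib inner_diff_right inner_add_right)
    also have "\<dots> \<le> p \<bullet> (T x *v \<xi>' + h x) + l * ref_dist wp wm \<xi> \<xi>'"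
      unfolding ref_dist_def by (intro add_left_mono dual_slope_le[OF w feas p])
    finally have "ereal (p \<bullet> (T x *v \<xi> + h x)) \<le> ereal (p \<bullet> (T x *v \<xi>' + h x)) + ereal (l * ref_dist wp wm \<xi> \<xi>')"
      by simp
    also have "\<dots> \<le> ?Z \<xi>' + ereal (l * ref_dist wp wm \<xi> \<xi>')"
      unfolding recourse_eq_SUP[OF rec] using p by (intro add_right_mono SUP_upper)
    finally show "ereal (p \<bullet> (T x *v \<xi> + h x)) \<le> ?Z \<xi>' + ereal (l * ref_dist wp wm \<xi> \<xi>')" .
  qed
  have Zs: "?Z (s i) \<le> ereal (q \<bullet> y i)" if "i \<in> {1..n}" for i
    using feas that unfolding recourse_def lp_feasible_def by (intro INF_lower) auto
  define v where "v = (\<lambda>\<xi>. real_of_ereal (?Z \<xi>))"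
  have Z: "?Z \<xi> = ereal (v \<xi>)" for \<xi>
  proof -
    \<comment> \<open>Sample 1 exists because \<open>n \<ge> 1\<close>; its finite upper bound
      spreads to all \<open>\<xi>\<close> by the Lipschitz property.\<close>
    have "?Z \<xi> \<le> ereal (q \<bullet> y 1) + ereal (l * ref_dist wp wm \<xi> (s 1))"
      using n by (intro order_trans[OF lipZ[of \<xi> "s 1"]] add_right_mono Zs) auto
    then have "?Z \<xi> \<noteq> \<infinity>" by auto
    moreover have "ereal (p0 \<bullet> (T x *v \<xi> + h x)) \<le> ?Z \<xi>"
      unfolding recourse_eq_SUP[OF rec] using p0 by (rule SUP_upper)
    then have "?Z \<xi> \<noteq> - \<infinity>" by auto
    ultimately show ?thesis by (cases "?Z \<xi>") (auto simp: v_def)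
  qed
  have meas: "v \<in> borel_measurable borel"
    using borel_measurable_recourse[OF rec, of T h x] unfolding v_def by measurable
  have lip: "v \<xi> \<le> v \<xi>' + l * ref_dist wp wm \<xi> \<xi>'" for \<xi> \<xi>'
    using lipZ[of \<xi> \<xi>'] by (simp add: Z)
  have "worst_case q W T h wp wm \<epsilon> n s x \<le> ereal (1 / real n * (\<Sum>i = 1..n. q \<bullet> y i) + l * \<epsilon>)"
    unfolding worst_case_def
  proof (rule SUP_least)
    fix P assume P: "P \<in> wasserstein_ball (ref_dist wp wm) \<epsilon> (empirical n s)"
    then have "P \<in> finite_moment_distrs" by (simp add: wasserstein_ball_def)
    then have "integrable P v" by (rule integrable_finite_moment[OF w _ meas lip l])
    then have "ereal_expectation P ?Z = ereal (integral\<^sup>L P v)"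
      using ereal_expectation_ereal by (simp add: Z[abs_def])
    also have "integral\<^sup>L P v \<le> integral\<^sup>L (empirical n s) v + l * \<epsilon>"
      using \<epsilon> by (intro wasserstein_ball_integral_le[OF w P empirical_finite_moment[OF n] meas lip l]) simp
    also have "integral\<^sup>L (empirical n s) v \<le> 1 / real n * (\<Sum>i = 1..n. q \<bullet> y i)"
      unfolding integral_empirical[OF n meas] using Zs
      by (intro mult_left_mono sum_mono) (auto simp: Z)
    finally show "ereal_expectation P ?Z \<le> ereal (1 / real n * (\<Sum>i = 1..n. q \<bullet> y i) + l * \<epsilon>)"
      by simp
  qed
  then have "ereal (c \<bullet> x) + worst_case q W T h wp wm \<epsilon> n s x
      \<le> ereal (c \<bullet> x) + ereal (1 / real n * (\<Sum>i = 1..n. q \<bullet> y i) + l * \<epsilon>)"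
    by (rule add_left_mono)
  then show ?thesis by (simp add: lp_objective_def algebra_simps)
qed

section \<open>Equality of the values, for fixed \<open>x\<close> and jointly\<close>

theorem theorem6:
  fixes c :: "real ^ 'n1" and X :: "(real ^ 'n1) set"
    and q :: "real ^ 'n2" and W :: "real ^ 'n2 ^ 'm"
    and T :: "real ^ 'n1 \<Rightarrow> real ^ 'k ^ 'm" and h :: "real ^ 'n1 \<Rightarrow> real ^ 'm"
    and wp wm \<epsilon> :: real and n :: nat and s :: "nat \<Rightarrow> real ^ 'k"
  assumes "affine_fun T" and "affine_fun h"
    and "sufficiently_expensive q W"
    and "wp > 0" and "wm > 0" and "\<epsilon> > 0" and "n \<ge> 1"
  shows "(\<forall>x\<in>X.
           (INF (l, y, \<phi>, \<psi>) \<in> {(l, y, \<phi>, \<psi>). lp_feasible X q W T h wp wm n s x l y \<phi> \<psi>}.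
              ereal (lp_objective c q \<epsilon> n x l y))
           = ereal (c \<bullet> x) + worst_case q W T h wp wm \<epsilon> n s x) \<and>
         (INF (x, l, y, \<phi>, \<psi>) \<in> {(x, l, y, \<phi>, \<psi>). lp_feasible X q W T h wp wm n s x l y \<phi> \<psi>}.
            ereal (lp_objective c q \<epsilon> n x l y))
         = (INF x\<in>X. ereal (c \<bullet> x) + worst_case q W T h wp wm \<epsilon> n s x)"
proof (intro conjI ballI)
  note lower = worst_case_le_objective[OF assms(3-7)]
  fix x assume x: "x \<in> X"
  show "(INF (l, y, \<phi>, \<psi>) \<in> {(l, y, \<phi>, \<psi>). lp_feasible X q W T h wp wm n s x l y \<phi> \<psi>}.
      ereal (lp_objective c q \<epsilon> n x l y)) = ereal (c \<bullet> x) + worst_case q W T h wp wm \<epsilon> n s x"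
    by (intro antisym lp_value_le_worst_case[OF assms(3-7) x] INF_greatest) (auto intro: lower)
next
  note lower = worst_case_le_objective[OF assms(3-7)]
  show "(INF (x, l, y, \<phi>, \<psi>) \<in> {(x, l, y, \<phi>, \<psi>). lp_feasible X q W T h wp wm n s x l y \<phi> \<psi>}.
      ereal (lp_objective c q \<epsilon> n x l y)) = (INF x\<in>X. ereal (c \<bullet> x) + worst_case q W T h wp wm \<epsilon> n s x)"
  proof (intro antisym INF_greatest)
    fix x assume x: "x \<in> X"
    \<comment> \<open>Fixing \<open>x\<close> restricts the joint minimization to one fibre, which
      can only raise the infimum.\<close>
    have "(INF (x, l, y, \<phi>, \<psi>) \<in> {(x, l, y, \<phi>, \<psi>). lp_feasible X q W T h wp wm n s x l y \<phi> \<psi>}.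
        ereal (lp_objective c q \<epsilon> n x l y))
      \<le> (INF (l, y, \<phi>, \<psi>) \<in> {(l, y, \<phi>, \<psi>). lp_feasible X q W T h wp wm n s x l y \<phi> \<psi>}.
        ereal (lp_objective c q \<epsilon> n x l y))"
    proof (rule INF_greatest)
      fix u assume "u \<in> {(l, y, \<phi>, \<psi>). lp_feasible X q W T h wp wm n s x l y \<phi> \<psi>}"
      then show "(INF (x, l, y, \<phi>, \<psi>) \<in> {(x, l, y, \<phi>, \<psi>). lp_feasible X q W T h wp wm n s x l y \<phi> \<psi>}.
          ereal (lp_objective c q \<epsilon> n x l y)) \<le> (case u of (l, y, \<phi>, \<psi>) \<Rightarrow> ereal (lp_objective c q \<epsilon> n x l y))"
        by (intro INF_lower2[of "(x, u)"]) auto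
    qed
    also have "\<dots> \<le> ereal (c \<bullet> x) + worst_case q W T h wp wm \<epsilon> n s x"
      by (rule lp_value_le_worst_case[OF assms(3-7) x])
    finally show "(INF (x, l, y, \<phi>, \<psi>) \<in> {(x, l, y, \<phi>, \<psi>). lp_feasible X q W T h wp wm n s x l y \<phi> \<psi>}.
        ereal (lp_objective c q \<epsilon> n x l y)) \<le> ereal (c \<bullet> x) + worst_case q W T h wp wm \<epsilon> n s x" .
  next
    fix u assume "u \<in> {(x, l, y, \<phi>, \<psi>). lp_feasible X q W T h wp wm n s x l y \<phi> \<psi>}"
    moreover obtain x l y \<phi> \<psi> where u: "u = (x, l, y, \<phi>, \<psi>)" by (cases u)
    ultimately have feas: "lp_feasible X q W T h wp wm n s x l y \<phi> \<psi>" by simp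
    then have "x \<in> X" by (simp add: lp_feasible_def)
    then show "(INF x\<in>X. ereal (c \<bullet> x) + worst_case q W T h wp wm \<epsilon> n s x)
        \<le> (case u of (x, l, y, \<phi>, \<psi>) \<Rightarrow> ereal (lp_objective c q \<epsilon> n x l y))"
      unfolding u using lower[OF feas] by (intro INF_lower2[of x]) auto
  qed
qed

end
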